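(* Let $r\ge 2$ be an integer. There exists a constant $c_r>0$ depending only on $r$ such that every graph $G$ with $m$ edges satisfying $\lambda(G)^2 > (1-\frac{1}{r})\,2m$ contains a copy of the generalized book $B_{r,k}$ with $k \ge c_r\sqrt{m}$. Furthermore, there exist a constant $C_r$ and, for infinitely many $m$, graphs $G$ with $m$ edges and $\lambda(G)^2 > (1-\frac{1}{r})\,2m$ that contain no copy of $B_{r,k}$ with $k > C_r\sqrt{m}$.
   Context: All graphs are finite, simple and undirected; $\lambda(G)$ denotes the largest eigenvalue of the adjacency matrix of $G$. The generalized book $B_{r,k}=K_r\vee I_k$ is the graph obtained by joining every vertex of a clique $K_r$ to every vertex of an independent set $I_k$ of size $k$ (i.e. $k$ copies of $K_{r+1}$ sharing a common $K_r$). *)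

theory Defs
  imports Complex_Main "Jordan_Normal_Form.Spectral_Radius"
begin

text \<open>
  A finite simple undirected graph is given by its order \<open>n\<close> and its set of edges \<open>E\<close>; the
  vertices are the numbers below \<open>n\<close>, so every finite graph occurs up to isomorphism.
  The order is positive, as the graph on no vertices has no eigenvalue.
\<close>

definition simple_graph :: "nat \<Rightarrow> nat set set \<Rightarrow> bool" where
  "simple_graph n E \<longleftrightarrow> 0 < n \<and> (\<forall>e\<in>E. e \<subseteq> {..<n} \<and> card e = 2)"

definition adjacency_matrix :: "nat \<Rightarrow> nat set set \<Rightarrow> real mat" where
  "adjacency_matrix n E = mat n n (\<lambda>(i, j). if {i, j} \<in> E then 1 else 0)"

text \<open>The adjacency matrix is symmetric, so all its eigenvalues are real and the spectrum over
  the reals is the whole spectrum; it is finite and nonempty, hence the maximum is attained.\<close>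

definition largest_eigenvalue :: "nat \<Rightarrow> nat set set \<Rightarrow> real" where
  "largest_eigenvalue n E = Max (spectrum (adjacency_matrix n E))"

text \<open>The generalized book on \<open>r + k\<close> vertices: the clique is on the vertices below \<open>r\<close>, the
  independent set consists of the remaining \<open>k\<close> vertices.\<close>

definition book_edges :: "nat \<Rightarrow> nat \<Rightarrow> nat set set" where
  "book_edges r k =
     {{i, j} | i j. i < r \<and> j < r \<and> i \<noteq> j} \<union> {{i, j} | i j. i < r \<and> r \<le> j \<and> j < r + k}"

text \<open>A copy of the graph \<open>(p, F)\<close> in \<open>(n, E)\<close> is a subgraph, not necessarily induced.\<close>

definition contains_copy :: "nat \<Rightarrow> nat set set \<Rightarrow> nat \<Rightarrow> nat set set \<Rightarrow> bool" where
  "contains_copy n E p F \<longleftrightarrow>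
     (\<exists>f. inj_on f {..<p} \<and> f ` {..<p} \<subseteq> {..<n} \<and> (\<forall>e\<in>F. f ` e \<in> E))"

abbreviation contains_book :: "nat \<Rightarrow> nat set set \<Rightarrow> nat \<Rightarrow> nat \<Rightarrow> bool" where
  "contains_book n E r k \<equiv> contains_copy n E (r + k) (book_edges r k)"

end

theory Submission
  imports Defs "HOL-Analysis.Convex"
begin

text \<open>
  Let \<open>x\<close> be the entrywise absolute value of a unit eigenvector of \<open>\<lambda>\<close>, so that \<open>L = x\<^sup>T A x\<close> is at
  least \<open>\<bar>\<lambda>\<bar>\<close>, and put \<open>\<tau> = L / (2m)\<close>, which is at most \<open>1 / \<surd>m\<close>. Cauchy--Schwarz would bound
  \<open>L\<^sup>2 / (2m)\<close> by the edge density of \<open>G\<close> in the vertex weights \<open>y = x\<^sup>2\<close>. Giving the edge \<open>ij\<close> only the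
  truncated weight \<open>h\<^sub>i\<^sub>j = max 0 (2 \<tau> x\<^sub>i x\<^sub>j - \<tau>\<^sup>2) \<le> y\<^sub>i y\<^sub>j\<close> still leaves a density above \<open>1 - 1/r\<close>.
  Discarding vertices of small \<open>h\<close>-degree keeps a constant proportion of the weight, and
  Motzkin--Straus yields an \<open>(r+1)\<close>-clique \<open>Q\<close> of positive \<open>h\<close> among the remaining vertices. The
  degree sum over \<open>Q\<close> exceeds \<open>r - 1\<close> times the total weight by a constant factor, so the vertices
  with at least \<open>r\<close> neighbours in \<open>Q\<close> account for a constant amount. The truncation prevents this
  amount from sitting on few heavy vertices: every vertex of \<open>Q\<close> except at most one has
  \<open>x\<^sub>v \<ge> \<surd>\<tau> / 2\<close>, whence \<open>h\<^sub>v\<^sub>j / y\<^sub>v \<le> 4 \<surd>\<tau> x\<^sub>j\<close>, and Cauchy--Schwarz gives order \<open>1 / \<tau>\<close> such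
  vertices. The pigeonhole principle selects the \<open>r\<close>-clique. Complete graphs show sharpness.
\<close>

section \<open>A weighted Motzkin--Straus inequality\<close>

lemma sum_sum_remove:
  fixes g :: "'a \<Rightarrow> 'a \<Rightarrow> real"
  assumes "finite V" "v \<in> V" and sym: "\<And>i j. g i j = g j i" and "g v v = 0"
  shows "(\<Sum>i\<in>V. \<Sum>j\<in>V. g i j) =
    (\<Sum>i\<in>V-{v}. \<Sum>j\<in>V-{v}. g i j) + 2 * (\<Sum>j\<in>V-{v}. g v j)"
proof -
  have inner: "(\<Sum>j\<in>V. g i j) = g i v + (\<Sum>j\<in>V-{v}. g i j)" for i
    using assms by (simp add: sum.remove)
  have "(\<Sum>i\<in>V. \<Sum>j\<in>V. g i j) = (\<Sum>j\<in>V. g v j) + (\<Sum>i\<in>V-{v}. \<Sum>j\<in>V. g i j)"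
    using assms(1,2) by (rule sum.remove)
  also have "\<dots> = (\<Sum>j\<in>V-{v}. g v j) + ((\<Sum>i\<in>V-{v}. g i v) + (\<Sum>i\<in>V-{v}. \<Sum>j\<in>V-{v}. g i j))"
    by (simp add: inner sum.distrib \<open>g v v = 0\<close>)
  also have "(\<Sum>i\<in>V-{v}. g i v) = (\<Sum>j\<in>V-{v}. g v j)"
    by (rule sum.cong) (use sym in auto)
  finally show ?thesis by simp
qed

text \<open>Induction on the number of vertices by symmetrisation: the form is linear when weight
  moves between two non-adjacent vertices, so one of them can take all of it. Once no non-adjacent
  pair is left, \<open>V\<close> is a clique with at most \<open>r\<close> vertices, and
  Cauchy--Schwarz finishes.\<close>

lemma motzkin_straus:
  fixes y :: "'a \<Rightarrow> real"
  assumes "finite V" and "r \<ge> 1"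
    and sym: "\<And>i j. adj i j \<Longrightarrow> adj j i" and irr: "\<And>i. \<not> adj i i"
    and "\<And>i. i \<in> V \<Longrightarrow> y i \<ge> 0"
    and "\<And>Q. Q \<subseteq> V \<Longrightarrow> card Q = r + 1 \<Longrightarrow> \<exists>i\<in>Q. \<exists>j\<in>Q. i \<noteq> j \<and> \<not> adj i j"
  shows "(\<Sum>i\<in>V. \<Sum>j\<in>V. if adj i j then y i * y j else 0) \<le> (1 - 1 / real r) * (\<Sum>i\<in>V. y i)\<^sup>2"
  using assms(1,5,6)
proof (induction "card V" arbitrary: V y rule: less_induct)
  case less
  note fin = less.prems(1) and nn = less.prems(2) and noc = less.prems(3)
  show ?case
  proof (cases "\<exists>u\<in>V. \<exists>v\<in>V. u \<noteq> v \<and> \<not> adj u v")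
    case False
    have le: "card V \<le> r"
    proof (rule ccontr)
      assume "\<not> card V \<le> r"
      then obtain Q where "Q \<subseteq> V" "card Q = r + 1"
        using obtain_subset_with_card_n[of "r + 1" V] by auto
      with noc False show False by blast
    qed
    have "(\<Sum>i\<in>V. \<Sum>j\<in>V. if adj i j then y i * y j else 0) =
          (\<Sum>i\<in>V. \<Sum>j\<in>V. y i * y j - (if i = j then y i * y j else 0))"
      using False irr by (intro sum.cong refl) auto
    also have "\<dots> = (\<Sum>i\<in>V. y i)\<^sup>2 - (\<Sum>i\<in>V. (y i)\<^sup>2)"
      using fin by (simp add: sum_subtractf sum_product power2_eq_square)
    finally have eq: "(\<Sum>i\<in>V. \<Sum>j\<in>V. if adj i j then y i * y j else 0)
        = (\<Sum>i\<in>V. y i)\<^sup>2 - (\<Sum>i\<in>V. (y i)\<^sup>2)" .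
    have "(\<Sum>i\<in>V. y i)\<^sup>2 \<le> real (card V) * (\<Sum>i\<in>V. (y i)\<^sup>2)"
      using Cauchy_Schwarz_ineq_sum[of "\<lambda>_. 1" y V] by simp
    also have "\<dots> \<le> real r * (\<Sum>i\<in>V. (y i)\<^sup>2)"
      using le by (intro mult_right_mono sum_nonneg) auto
    finally have "(\<Sum>i\<in>V. y i)\<^sup>2 / real r \<le> (\<Sum>i\<in>V. (y i)\<^sup>2)"
      using \<open>r \<ge> 1\<close> by (simp add: field_simps)
    then show ?thesis unfolding eq by (simp add: algebra_simps)
  next
    case True
    define d where "d v = (\<Sum>j\<in>V. if adj v j then y j else 0)" for v
    obtain u v where uv: "u \<in> V" "v \<in> V" "u \<noteq> v" "\<not> adj u v" "d u \<le> d v"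
      using True sym by (metis linear)
    \<comment> \<open>Merging \<open>u\<close> into its non-neighbour \<open>v\<close> of larger degree does not decrease the form.\<close>
    define W where "W = V - {u}"
    define y' where "y' = y(v := y u + y v)"
    define q where "q z i j = (if adj i j then z i * z j else 0)" for z :: "'a \<Rightarrow> real" and i j
    have qsym: "q z i j = q z j i" for z i j using sym by (auto simp: q_def)
    have q0: "q z i i = 0" for z i using irr by (simp add: q_def)
    have nadj: "\<not> adj v u" using uv sym by blast
    have y'_eq: "y' i = y i" if "i \<noteq> v" for i using that by (simp add: y'_def)
    have Wv: "v \<in> W" "finite W" "W \<subseteq> V" using uv fin by (auto simp: W_def)
    have row_u: "(\<Sum>j\<in>V-{u}. q y u j) = y u * d u"
    proof -
      have "(\<Sum>j\<in>V-{u}. q y u j) = (\<Sum>j\<in>V. q y u j)"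
        using fin uv q0 by (simp add: sum.remove)
      then show ?thesis by (simp add: d_def sum_distrib_left q_def if_distrib cong: if_cong)
    qed
    \<comment> \<open>The slope \<open>d v\<close> is the same for \<open>y\<close> and
      \<open>y'\<close>: neither \<open>u\<close> nor \<open>v\<close> is a neighbour of
      \<open>v\<close>, so their weights do not enter it.\<close>
    have row_v: "(\<Sum>j\<in>W-{v}. q z v j) = z v * d v" if "\<And>j. j \<noteq> v \<Longrightarrow> z j = y j" for z
    proof -
      have "(\<Sum>j\<in>W-{v}. q z v j) = (\<Sum>j\<in>V. q z v j)"
        using nadj irr fin by (intro sum.mono_neutral_left) (auto simp: W_def q_def)
      also have "\<dots> = (\<Sum>j\<in>V. z v * (if adj v j then y j else 0))"
        using irr that by (intro sum.cong refl) (auto simp: q_def, metis)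
      finally show ?thesis by (simp add: d_def sum_distrib_left)
    qed
    have rest: "(\<Sum>i\<in>W-{v}. \<Sum>j\<in>W-{v}. q y' i j) = (\<Sum>i\<in>W-{v}. \<Sum>j\<in>W-{v}. q y i j)"
      by (intro sum.cong refl) (auto simp: q_def y'_eq)
    have "(\<Sum>i\<in>V. \<Sum>j\<in>V. q y i j) =
       (\<Sum>i\<in>W-{v}. \<Sum>j\<in>W-{v}. q y i j) + 2 * (y v * d v) + 2 * (y u * d u)"
      using sum_sum_remove[OF fin uv(1), of "q y", OF qsym q0]
        sum_sum_remove[OF Wv(2,1), of "q y", OF qsym q0] row_u row_v[of y]
      by (simp add: W_def)
    also have "\<dots> \<le> (\<Sum>i\<in>W-{v}. \<Sum>j\<in>W-{v}. q y' i j) + 2 * (y' v * d v)"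
      unfolding rest using mult_left_mono[OF uv(5) nn[OF uv(1)]] by (simp add: y'_def algebra_simps)
    also have "\<dots> = (\<Sum>i\<in>W. \<Sum>j\<in>W. q y' i j)"
      using sum_sum_remove[OF Wv(2,1), of "q y'", OF qsym q0] row_v[of y'] y'_eq by simp
    also have "\<dots> \<le> (1 - 1 / real r) * (\<Sum>i\<in>W. y' i)\<^sup>2"
      unfolding q_def
    proof (rule less.hyps)
      show "card W < card V" unfolding W_def using uv fin by (intro card_Diff1_less)
      show "y' i \<ge> 0" if "i \<in> W" for i using that nn uv Wv by (auto simp: y'_def)
    qed (use Wv noc in auto)
    also have "(\<Sum>i\<in>W. y' i) = (\<Sum>i\<in>V. y i)"
    proof -
      have "(\<Sum>i\<in>W. y' i) = y' v + (\<Sum>i\<in>W-{v}. y' i)" using Wv by (simp add: sum.remove)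
      also have "(\<Sum>i\<in>W-{v}. y' i) = (\<Sum>i\<in>W-{v}. y i)"
        by (intro sum.cong refl) (auto simp: y'_eq)
      also have "y' v + \<dots> = y u + (\<Sum>i\<in>W. y i)" using Wv by (simp add: sum.remove y'_def)
      also have "\<dots> = (\<Sum>i\<in>V. y i)" using fin uv by (simp add: W_def sum.remove)
      finally show ?thesis .
    qed
    finally show ?thesis by (simp add: q_def)
  qed
qed

section \<open>Truncated edge weights and a clique with many near neighbours\<close>

text \<open>\<open>U\<close> maximises the total \<open>h\<close>-weight minus \<gamma> times the
  squared vertex weight. Comparison with \<open>V\<close> bounds density and weight of
  \<open>U\<close> from below; comparison with \<open>U - {v}\<close> bounds the degree of
  \<open>v\<close>, where \<open>y v / 2\<close> is the quadratic term of the difference of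
  squares.\<close>

lemma dense_subset_min_degree:
  fixes h :: "'a \<Rightarrow> 'a \<Rightarrow> real" and y :: "'a \<Rightarrow> real"
  assumes "finite V" and sym: "\<And>i j. h i j = h j i" and diag: "\<And>i. h i i = 0"
    and ub: "\<And>i j. h i j \<le> y i * y j" and nn: "\<And>i. 0 \<le> y i"
    and one: "(\<Sum>i\<in>V. y i) = 1" and dense: "(\<Sum>i\<in>V. \<Sum>j\<in>V. h i j) > \<alpha>"
    and "0 \<le> \<gamma>" "\<gamma> < \<alpha>"
  obtains U where "U \<subseteq> V" "(\<Sum>i\<in>U. \<Sum>j\<in>U. h i j) > \<alpha> * (\<Sum>i\<in>U. y i)\<^sup>2"
    "(\<Sum>i\<in>U. y i) > \<alpha> - \<gamma>"
    "\<And>v. v \<in> U \<Longrightarrow> (\<Sum>j\<in>U. h v j) \<ge> \<gamma> * y v * ((\<Sum>i\<in>U. y i) - y v / 2)"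
proof -
  define S where "S U = (\<Sum>i\<in>U. \<Sum>j\<in>U. h i j)" for U
  define Y where "Y U = (\<Sum>i\<in>U. y i)" for U
  define f where "f U = S U - \<gamma> * (Y U)\<^sup>2" for U
  have "Max (f ` Pow V) \<in> f ` Pow V" using \<open>finite V\<close> by (intro Max_in) auto
  then obtain U where U: "U \<subseteq> V" "f U = Max (f ` Pow V)" by auto
  have max: "f W \<le> f U" if "W \<subseteq> V" for W
    unfolding U(2) using that \<open>finite V\<close> by (intro Max_ge) auto
  have finU: "finite U" using U \<open>finite V\<close> finite_subset by blast
  have fU: "f U > \<alpha> - \<gamma>" using max[of V] dense one by (simp add: f_def S_def Y_def)
  have Y0: "Y U \<ge> 0" unfolding Y_def using nn by (simp add: sum_nonneg)
  have Y1: "Y U \<le> 1" unfolding one[symmetric] Y_def using U \<open>finite V\<close> nn by (intro sum_mono2) auto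
  have Ysq: "(Y U)\<^sup>2 \<le> 1" using Y0 Y1 by (simp add: power_le_one)
  have SY: "S U \<le> (Y U)\<^sup>2"
    unfolding S_def Y_def power2_eq_square sum_product using ub by (intro sum_mono) auto
  have "\<alpha> * (Y U)\<^sup>2 = \<gamma> * (Y U)\<^sup>2 + (\<alpha> - \<gamma>) * (Y U)\<^sup>2" by (simp add: algebra_simps)
  also have "\<dots> \<le> \<gamma> * (Y U)\<^sup>2 + (\<alpha> - \<gamma>)"
    using Ysq \<open>\<gamma> < \<alpha>\<close> mult_left_mono[OF Ysq, of "\<alpha> - \<gamma>"] by simp
  also have "\<dots> < S U" using fU by (simp add: f_def)
  finally have 1: "S U > \<alpha> * (Y U)\<^sup>2" .
  have "(Y U)\<^sup>2 \<le> Y U" using Y0 Y1 by (simp add: power2_eq_square mult_left_le)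
  then have 2: "Y U > \<alpha> - \<gamma>"
    using fU SY mult_nonneg_nonneg[OF \<open>0 \<le> \<gamma>\<close> zero_le_power2[of "Y U"]] by (simp add: f_def)
  have 3: "(\<Sum>j\<in>U. h v j) \<ge> \<gamma> * y v * (Y U - y v / 2)" if "v \<in> U" for v
  proof -
    have "S U = S (U - {v}) + 2 * (\<Sum>j\<in>U-{v}. h v j)"
      unfolding S_def by (rule sum_sum_remove[OF finU that sym diag])
    moreover have "(\<Sum>j\<in>U. h v j) = (\<Sum>j\<in>U-{v}. h v j)"
      using finU that diag by (simp add: sum.remove)
    moreover have "Y U = y v + Y (U - {v})" unfolding Y_def using finU that by (simp add: sum.remove)
    moreover have "f (U - {v}) \<le> f U" using U by (intro max) auto
    ultimately show ?thesis by (simp add: f_def power2_eq_square algebra_simps)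
  qed
  show thesis using that[of U] U(1) 1 2 3 unfolding S_def Y_def by blast
qed

text \<open>The first factor is the square of the constant \<open>a\<close> in the double count
  below, the second is \<open>\<alpha> - \<gamma>\<close>, a lower bound for the weight of the dense
  subset.\<close>

definition book_const :: "nat \<Rightarrow> real" where
  "book_const r = ((real r - 1) / (32 * real r * (real r + 1)))\<^sup>2 * ((real r - 1) / (4 * (real r)\<^sup>2))"

lemma book_const_pos: "r \<ge> 2 \<Longrightarrow> book_const r > 0"
  by (auto simp: book_const_def intro!: mult_pos_pos divide_pos_pos)

text \<open>Here \<open>s\<close> is the square root of the truncation level. The sum of
  \<open>h v j / y v\<close> over \<open>v\<close> in the clique and \<open>j\<close> in the dense
  subset is counted in two ways: minimum degrees bound it from below, and the number of clique
  neighbours of each \<open>j\<close> bounds it from above.\<close>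

lemma clique_with_many_near_neighbours:
  fixes adj :: "'a \<Rightarrow> 'a \<Rightarrow> bool" and x :: "'a \<Rightarrow> real" and r :: nat and s :: real
  defines "h \<equiv> \<lambda>i j. if adj i j then max 0 (2 * s\<^sup>2 * (x i * x j) - s ^ 4) else 0"
  assumes "finite V" and r: "r \<ge> 2"
    and sym: "\<And>i j. adj i j \<Longrightarrow> adj j i" and irr: "\<And>i. \<not> adj i i"
    and x0: "\<And>i. 0 \<le> x i" and one: "(\<Sum>i\<in>V. (x i)\<^sup>2) = 1" and s: "s > 0"
    and dense: "(\<Sum>i\<in>V. \<Sum>j\<in>V. h i j) > 1 - 1 / real r"
  obtains Q where "Q \<subseteq> V" "card Q = r + 1" "\<And>i j. i \<in> Q \<Longrightarrow> j \<in> Q \<Longrightarrow> i \<noteq> j \<Longrightarrow> adj i j"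
    "s\<^sup>2 * real (card {j \<in> V. r \<le> card {v \<in> Q. adj v j}}) \<ge> book_const r"
proof -
  define y where "y i = (x i)\<^sup>2" for i
  define \<alpha> where "\<alpha> = 1 - 1 / real r"
  \<comment> \<open>The loss factor is close enough to 1 that \<open>\<gamma> * (r + 1 / 2)\<close>
    still exceeds \<open>r - 1\<close>, yet leaves \<open>\<alpha> - \<gamma>\<close>
    positive.\<close>
  define \<gamma> where "\<gamma> = \<alpha> * (1 - 1 / (4 * real r))"
  have \<alpha>0: "\<alpha> > 0" using r by (simp add: \<alpha>_def)
  have \<gamma>0: "\<gamma> \<ge> 0" using r \<alpha>0 by (simp add: \<gamma>_def field_simps)
  have \<alpha>\<gamma>: "\<alpha> - \<gamma> = (real r - 1) / (4 * (real r)\<^sup>2)"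
    using r by (simp add: \<alpha>_def \<gamma>_def field_simps power2_eq_square)
  have "\<alpha> - \<gamma> > 0" unfolding \<alpha>\<gamma> using r by (intro divide_pos_pos) auto
  then have \<gamma>\<alpha>: "\<gamma> < \<alpha>" by simp
  have y0: "y i \<ge> 0" for i by (simp add: y_def)
  have hsym: "h i j = h j i" for i j using sym by (auto simp: h_def mult.commute)
  have h0: "h i j \<ge> 0" for i j by (simp add: h_def)
  have hd: "h i i = 0" for i using irr by (simp add: h_def)
  have hub: "h i j \<le> y i * y j" for i j
  proof -
    \<comment> \<open>The untruncated weight is the tangent to the square function at
      \<open>s\<^sup>2\<close>, evaluated at \<open>x i * x j\<close>.\<close>
    have "0 \<le> (x i * x j - s\<^sup>2)\<^sup>2" by simp
    then have "2 * s\<^sup>2 * (x i * x j) - s ^ 4 \<le> (x i)\<^sup>2 * (x j)\<^sup>2"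
      by (simp add: power2_eq_square power4_eq_xxxx algebra_simps)
    then show ?thesis by (simp add: h_def y_def)
  qed
  obtain U where U: "U \<subseteq> V" "(\<Sum>i\<in>U. \<Sum>j\<in>U. h i j) > \<alpha> * (\<Sum>i\<in>U. y i)\<^sup>2"
      "(\<Sum>i\<in>U. y i) > \<alpha> - \<gamma>"
      and deg: "\<And>v. v \<in> U \<Longrightarrow> (\<Sum>j\<in>U. h v j) \<ge> \<gamma> * y v * ((\<Sum>i\<in>U. y i) - y v / 2)"
    using dense_subset_min_degree[of V h y \<alpha> \<gamma>, OF \<open>finite V\<close> hsym hd hub y0 _ _ \<gamma>0 \<gamma>\<alpha>] one dense
    unfolding y_def \<alpha>_def by metis
  define Y where "Y = (\<Sum>i\<in>U. y i)"
  have finU: "finite U" using U \<open>finite V\<close> finite_subset by blast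
  \<comment> \<open>Otherwise Motzkin--Straus for the graph of pairs with positive \<open>h\<close>
    contradicts the density of \<open>U\<close>.\<close>
  have "\<exists>Q\<subseteq>U. card Q = r + 1 \<and> (\<forall>i\<in>Q. \<forall>j\<in>Q. i \<noteq> j \<longrightarrow> h i j > 0)"
  proof (rule ccontr)
    assume no: "\<not> ?thesis"
    have "(\<Sum>i\<in>U. \<Sum>j\<in>U. h i j) \<le> (\<Sum>i\<in>U. \<Sum>j\<in>U. if h i j > 0 then y i * y j else 0)"
      using hub h0 by (intro sum_mono) (auto simp: not_less)
    also have "\<dots> \<le> (1 - 1 / real r) * (\<Sum>i\<in>U. y i)\<^sup>2"
    proof (rule motzkin_straus[OF finU])
      show "\<exists>i\<in>Q. \<exists>j\<in>Q. i \<noteq> j \<and> \<not> 0 < h i j" if "Q \<subseteq> U" "card Q = r + 1" for Q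
        using no that by blast
    qed (use r hsym hd y0 in auto)
    finally show False using U(2) by (simp add: \<alpha>_def)
  qed
  then obtain Q where Q: "Q \<subseteq> U" "card Q = r + 1" and
    Qh: "\<And>i j. i \<in> Q \<Longrightarrow> j \<in> Q \<Longrightarrow> i \<noteq> j \<Longrightarrow> h i j > 0" by blast
  have finQ: "finite Q" using Q finU finite_subset by blast
  have adjQ: "adj i j" and heavy: "2 * (x i * x j) > s\<^sup>2" if "i \<in> Q" "j \<in> Q" "i \<noteq> j" for i j
  proof -
    show "adj i j" using Qh[OF that] by (simp add: h_def split: if_splits)
    have "2 * s\<^sup>2 * (x i * x j) - s ^ 4 > 0"
      using Qh[OF that] by (simp add: h_def max_def split: if_splits)
    then have "s\<^sup>2 * (2 * (x i * x j) - s\<^sup>2) > 0"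
      by (simp add: power2_eq_square power4_eq_xxxx algebra_simps)
    then show "2 * (x i * x j) > s\<^sup>2" using s by (simp add: zero_less_mult_iff)
  qed
  have xpos: "x v > 0" if "v \<in> Q" for v
  proof -
    have "Q - {v} \<noteq> {}"
    proof
      assume "Q - {v} = {}"
      then have "card Q \<le> card {v}" by (intro card_mono) auto
      then show False using Q(2) r by simp
    qed
    then obtain w where "w \<in> Q" "v \<noteq> w" by blast
    from heavy[OF that this] have "x v \<noteq> 0" using s by (auto simp: zero_less_power2 not_less)
    then show ?thesis using x0[of v] by simp
  qed
  \<comment> \<open>The edges inside \<open>Q\<close> are heavy, so at most one vertex of \<open>Q\<close> is light.\<close>
  define B where "B = {v \<in> Q. s / 2 \<le> x v}"
  have light: "card (Q - B) \<le> 1"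
  proof -
    have "v = w" if "v \<in> Q - B" "w \<in> Q - B" for v w
    proof (rule ccontr)
      assume "v \<noteq> w"
      have "x v * x w \<le> (s / 2) * (s / 2)"
        using that x0 s by (intro mult_mono) (auto simp: B_def)
      moreover have "2 * (x v * x w) > s\<^sup>2" using that \<open>v \<noteq> w\<close> by (intro heavy) auto
      ultimately show False using mult_pos_pos[OF s s] by (simp add: power2_eq_square)
    qed
    then show ?thesis using finQ card_le_Suc0_iff_eq[of "Q - B"] by auto
  qed
  \<comment> \<open>One factor \<open>s\<close> is traded for \<open>2 * x v\<close>, so that
    division by \<open>y v\<close> leaves a bound linear in \<open>x j\<close> and independent of
    \<open>v\<close>.\<close>
  have bigB: "h v j / y v \<le> 4 * s * x j" if "v \<in> B" for v j
  proof -
    have v: "x v > 0" "s \<le> 2 * x v" using that xpos by (auto simp: B_def)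
    have "h v j \<le> 2 * s\<^sup>2 * (x v * x j)"
      using x0 s by (auto simp: h_def)
    also have "\<dots> = 2 * s * x v * x j * s" by (simp add: power2_eq_square)
    also have "\<dots> \<le> 2 * s * x v * x j * (2 * x v)" using v s x0 by (intro mult_left_mono) auto
    finally show ?thesis using v by (simp add: y_def divide_simps power2_eq_square mult_ac)
  qed
  have anyQ: "h v j / y v \<le> (if adj v j then y j else 0)" if "v \<in> Q" for v j
  proof -
    have "y v > 0" using xpos[OF that] by (simp add: y_def)
    then show ?thesis using hub[of v j] by (auto simp: h_def field_simps)
  qed
  define T where "T = {j \<in> V. r \<le> card {v \<in> Q. adj v j}}"
  have finT: "finite T" using \<open>finite V\<close> by (simp add: T_def)
  \<comment> \<open>Outside \<open>T\<close> at most \<open>r - 1\<close> terms are nonzero, each at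
    most \<open>y j\<close>. Inside \<open>T\<close> the single possible light vertex gives at most
    \<open>y j\<close>, which \<open>(r - 1) * y j\<close> covers since \<open>r \<ge> 2\<close>,
    and each of the at most \<open>r + 1\<close> others gives at most
    \<open>4 * s * x j\<close>.\<close>
  have row: "(\<Sum>v\<in>Q. h v j / y v) \<le> (real r - 1) * y j + (if j \<in> T then 4 * (real r + 1) * s * x j else 0)"
    if "j \<in> U" for j
  proof (cases "j \<in> T")
    case True
    have "(\<Sum>v\<in>Q. h v j / y v) = (\<Sum>v\<in>Q-B. h v j / y v) + (\<Sum>v\<in>B. h v j / y v)"
      using finQ by (intro sum.subset_diff) (auto simp: B_def)
    also have "(\<Sum>v\<in>Q-B. h v j / y v) \<le> (\<Sum>v\<in>Q-B. y j)"
      using y0[of j] by (intro sum_mono order_trans[OF anyQ]) auto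
    also have "\<dots> \<le> (real r - 1) * y j"
      using light r mult_right_mono[of "real (card (Q - B))" "real r - 1" "y j"] y0[of j] by simp
    also have "(\<Sum>v\<in>B. h v j / y v) \<le> (\<Sum>v\<in>B. 4 * s * x j)" by (intro sum_mono bigB)
    also have "\<dots> = real (card B) * (4 * s * x j)" by simp
    also have "\<dots> \<le> (real r + 1) * (4 * s * x j)"
    proof (rule mult_right_mono)
      have "card B \<le> card Q" using finQ by (intro card_mono) (auto simp: B_def)
      then show "real (card B) \<le> real r + 1" using Q by simp
    qed (use s x0 in auto)
    finally show ?thesis using True by (simp add: mult_ac)
  next
    case False
    then have "card {v \<in> Q. adj v j} < r" using that U(1) by (auto simp: T_def)
    then have c: "real (card {v \<in> Q. adj v j}) \<le> real r - 1" by linarith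
    have "(\<Sum>v\<in>Q. h v j / y v) \<le> (\<Sum>v\<in>Q. if adj v j then y j else 0)"
      by (intro sum_mono anyQ)
    also have "\<dots> = real (card {v \<in> Q. adj v j}) * y j"
      using finQ by (simp add: sum.If_cases Int_def)
    also have "\<dots> \<le> (real r - 1) * y j" using c y0 by (rule mult_right_mono)
    finally show ?thesis using False by simp
  qed
  have QY: "(\<Sum>v\<in>Q. y v) \<le> Y" unfolding Y_def using Q finU y0 by (intro sum_mono2) auto
  have Ypos: "Y > 0" using U(3) \<gamma>\<alpha> by (simp add: Y_def)
  define X where "X = (\<Sum>j\<in>U\<inter>T. x j)"
  \<comment> \<open>The degree bounds are summed over the \<open>r + 1\<close> vertices of
    \<open>Q\<close>; the corrections \<open>y v / 2\<close> cost at most \<open>Y / 2\<close>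
    altogether.\<close>
  have "\<gamma> * (real r + 1 / 2) * Y = \<gamma> * ((real r + 1) * Y - Y / 2)" by (simp add: algebra_simps)
  also have "\<dots> \<le> \<gamma> * ((real r + 1) * Y - (\<Sum>v\<in>Q. y v) / 2)"
    using QY \<gamma>0 by (intro mult_left_mono) auto
  also have "\<dots> = (\<Sum>v\<in>Q. \<gamma> * (Y - y v / 2))"
    using Q by (simp add: sum_distrib_left[symmetric] sum_subtractf sum_divide_distrib[symmetric])
  also have "\<dots> \<le> (\<Sum>v\<in>Q. \<Sum>j\<in>U. h v j / y v)"
  proof (rule sum_mono)
    fix v assume v: "v \<in> Q"
    have "y v > 0" using xpos[OF v] by (simp add: y_def)
    then show "\<gamma> * (Y - y v / 2) \<le> (\<Sum>j\<in>U. h v j / y v)"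
      using deg[of v] v Q by (auto simp: Y_def sum_divide_distrib[symmetric] pos_le_divide_eq mult_ac)
  qed
  also have "\<dots> = (\<Sum>j\<in>U. \<Sum>v\<in>Q. h v j / y v)" by (rule sum.swap)
  also have "\<dots> \<le> (\<Sum>j\<in>U. (real r - 1) * y j + (if j \<in> T then 4 * (real r + 1) * s * x j else 0))"
    by (intro sum_mono row)
  also have "\<dots> = (real r - 1) * Y + 4 * (real r + 1) * s * X"
    using finU by (simp add: sum.distrib Y_def X_def sum_distrib_left flip: sum.inter_restrict)
  finally have main: "\<gamma> * (real r + 1 / 2) * Y \<le> (real r - 1) * Y + 4 * (real r + 1) * s * X" .
  \<comment> \<open>With this value \<open>4 * (r + 1) * a\<close> is
    \<open>(r - 1) / (8 * r)\<close>, which fits into the excess of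
    \<open>\<gamma> * (r + 1 / 2)\<close> over \<open>r - 1\<close>.\<close>
  define a where "a = (real r - 1) / (32 * real r * (real r + 1))"
  have a0: "a > 0" using r by (simp add: a_def)
  have "(real r - 1) + 4 * (real r + 1) * a \<le> \<gamma> * (real r + 1 / 2)"
  proof -
    have "\<gamma> * (real r + 1 / 2) - (real r - 1) - 4 * (real r + 1) * a = (real r - 1) * (real r - 1) / (8 * (real r)\<^sup>2)"
      using r by (simp add: \<gamma>_def \<alpha>_def a_def divide_simps power2_eq_square) (simp add: algebra_simps)
    also have "\<dots> \<ge> 0" by simp
    finally show ?thesis by linarith
  qed
  from mult_right_mono[OF this, of Y] main Ypos
  have "(4 * (real r + 1)) * (a * Y) \<le> (4 * (real r + 1)) * (s * X)" by (simp add: algebra_simps)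
  then have aY: "a * Y \<le> s * X" using r by (subst (asm) mult_le_cancel_left_pos) auto
  \<comment> \<open>Cauchy--Schwarz turns the lower bound on \<open>X\<close> into one on
    \<open>card T\<close>; one factor \<open>Y\<close> then cancels and the other is at least
    \<open>\<alpha> - \<gamma>\<close>.\<close>
  have "X\<^sup>2 \<le> real (card (U \<inter> T)) * (\<Sum>j\<in>U\<inter>T. y j)"
    unfolding X_def y_def using Cauchy_Schwarz_ineq_sum[of "\<lambda>_. 1" x "U \<inter> T"] by simp
  also have "\<dots> \<le> real (card T) * Y"
    unfolding Y_def using finT finU y0
    by (intro mult_mono sum_mono2 sum_nonneg) (auto intro: card_mono)
  finally have XT: "X\<^sup>2 \<le> real (card T) * Y" .
  have "(a * Y)\<^sup>2 \<le> (s * X)\<^sup>2" using aY a0 Ypos by (intro power_mono) auto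
  also have "\<dots> \<le> s\<^sup>2 * (real (card T) * Y)" using XT by (simp add: power_mult_distrib mult_left_mono)
  finally have "(a\<^sup>2 * Y) * Y \<le> (s\<^sup>2 * real (card T)) * Y" by (simp add: power2_eq_square mult_ac)
  then have "a\<^sup>2 * Y \<le> s\<^sup>2 * real (card T)" using Ypos by simp
  moreover have "a\<^sup>2 * (\<alpha> - \<gamma>) \<le> a\<^sup>2 * Y" using U(3) by (intro mult_left_mono) (auto simp: Y_def)
  ultimately have "book_const r \<le> s\<^sup>2 * real (card T)"
    unfolding \<alpha>\<gamma> by (simp add: book_const_def a_def)
  then show thesis using that[of Q] Q U(1) adjQ unfolding T_def by blast
qed

section \<open>Eigenvalues of real symmetric and nonnegative matrices\<close>

lemma eigenvector_entries:
  assumes A: "A \<in> carrier_mat n n" and "eigenvector A v k"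
  shows "i < n \<Longrightarrow> (\<Sum>j<n. A $$ (i, j) * v $ j) = k * v $ i" and "\<exists>i<n. v $ i \<noteq> 0"
proof -
  have v: "v \<in> carrier_vec n" "v \<noteq> 0\<^sub>v n" "A *\<^sub>v v = k \<cdot>\<^sub>v v"
    using assms by (auto simp: eigenvector_def)
  show "(\<Sum>j<n. A $$ (i, j) * v $ j) = k * v $ i" if "i < n"
  proof -
    have "(A *\<^sub>v v) $ i = (\<Sum>j<n. A $$ (i, j) * v $ j)"
      using A v(1) that by (auto simp: scalar_prod_def lessThan_atLeast0 intro!: sum.cong)
    then show ?thesis using v that by simp
  qed
  show "\<exists>i<n. v $ i \<noteq> 0"
  proof (rule ccontr)
    assume "\<not> ?thesis"
    then have "v = 0\<^sub>v n" using v(1) by (intro eq_vecI) auto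
    with v(2) show False ..
  qed
qed

text \<open>Guarantees that the \<open>Max\<close> defining the largest eigenvalue is attained. A
  complex eigenvalue \<open>c\<close> exists, and the Hermitian form \<open>z\<close> at its
  eigenvector equals its own conjugate, so \<open>c\<close> is real and a root of the real
  characteristic polynomial.\<close>

lemma symmetric_mat_spectrum_nonempty:
  fixes A :: "real mat"
  assumes A: "A \<in> carrier_mat n n" and "n > 0"
    and sym: "\<And>i j. i < n \<Longrightarrow> j < n \<Longrightarrow> A $$ (i, j) = A $$ (j, i)"
  shows "spectrum A \<noteq> {}"
proof -
  define B where "B = map_mat complex_of_real A"
  have B: "B \<in> carrier_mat n n" using A by (simp add: B_def)
  obtain c where c: "eigenvalue B c" using spectrum_non_empty[OF B \<open>n > 0\<close>] by (auto simp: spectrum_def)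
  then obtain v where v: "eigenvector B v c" by (auto simp: eigenvalue_def)
  have Bij: "B $$ (i, j) = of_real (A $$ (i, j))" if "i < n" "j < n" for i j
    using A that by (simp add: B_def)
  define N where "N = (\<Sum>i<n. (cmod (v $ i))\<^sup>2)"
  define z where "z = (\<Sum>i<n. \<Sum>j<n. cnj (v $ i) * of_real (A $$ (i, j)) * v $ j)"
  obtain i where "i < n" "v $ i \<noteq> 0" using eigenvector_entries(2)[OF B v] by blast
  then have N: "N > 0" unfolding N_def by (intro sum_pos2[of _ i]) auto
  have "z = (\<Sum>i<n. cnj (v $ i) * (\<Sum>j<n. B $$ (i, j) * v $ j))"
    unfolding z_def sum_distrib_left by (intro sum.cong refl) (simp add: Bij mult.assoc)
  also have "\<dots> = (\<Sum>i<n. cnj (v $ i) * (c * v $ i))"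
    using eigenvector_entries(1)[OF B v] by (intro sum.cong refl) simp
  also have "\<dots> = c * of_real N"
    unfolding N_def of_real_sum sum_distrib_left
    by (intro sum.cong refl) (simp add: complex_norm_square mult_ac del: of_real_power)
  finally have zN: "z = c * of_real N" .
  have "cnj z = (\<Sum>i<n. \<Sum>j<n. cnj (v $ j) * of_real (A $$ (i, j)) * v $ i)"
    by (simp add: z_def mult_ac)
  also have "\<dots> = (\<Sum>j<n. \<Sum>i<n. cnj (v $ j) * of_real (A $$ (i, j)) * v $ i)"
    by (rule sum.swap)
  also have "\<dots> = z" unfolding z_def using sym by (intro sum.cong refl) simp
  finally have "cnj c = c" using zN N by simp
  then have "c \<in> \<real>" by (simp add: Reals_cnj_iff)
  then obtain t where t: "c = of_real t" by (auto elim: Reals_cases)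
  have "poly (char_poly B) c = 0" using c eigenvalue_root_char_poly[OF B] by simp
  then have "poly (char_poly A) t = 0"
    unfolding B_def t of_real_hom.char_poly_hom[OF A] by simp
  then have "eigenvalue A t" using eigenvalue_root_char_poly[OF A] by simp
  then show ?thesis by (auto simp: spectrum_def)
qed

text \<open>Passing to absolute values of the entries of a normalised eigenvector can only increase
  the modulus of the form, by the triangle inequality. This yields a nonnegative vector without
  Perron--Frobenius.\<close>

lemma eigenvalue_le_nonneg_form:
  fixes A :: "real mat"
  assumes A: "A \<in> carrier_mat n n" and "eigenvalue A k"
    and A0: "\<And>i j. i < n \<Longrightarrow> j < n \<Longrightarrow> A $$ (i, j) \<ge> 0"
  obtains x :: "nat \<Rightarrow> real" where "\<And>i. x i \<ge> 0" "(\<Sum>i<n. (x i)\<^sup>2) = 1"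
    "\<bar>k\<bar> \<le> (\<Sum>i<n. \<Sum>j<n. A $$ (i, j) * (x i * x j))"
proof -
  obtain v where v: "eigenvector A v k" using assms by (auto simp: eigenvalue_def)
  define N where "N = (\<Sum>i<n. (v $ i)\<^sup>2)"
  obtain i where "i < n" "v $ i \<noteq> 0" using eigenvector_entries(2)[OF A v] by blast
  then have N: "N > 0" unfolding N_def by (intro sum_pos2[of _ i]) auto
  define x where "x i = \<bar>v $ i\<bar> / sqrt N" for i
  have xx: "x i * x j = \<bar>v $ i\<bar> * \<bar>v $ j\<bar> / N" for i j
    using N by (simp add: x_def field_simps)
  show thesis
  proof
    show "x i \<ge> 0" for i using N by (simp add: x_def)
    show "(\<Sum>i<n. (x i)\<^sup>2) = 1"
      using N by (simp add: power2_eq_square xx sum_divide_distrib[symmetric]) (simp add: N_def power2_eq_square)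
    have "k * N = (\<Sum>i<n. \<Sum>j<n. A $$ (i, j) * (v $ i * v $ j))"
    proof -
      have "k * N = (\<Sum>i<n. v $ i * (\<Sum>j<n. A $$ (i, j) * v $ j))"
        unfolding N_def sum_distrib_left[of k] using eigenvector_entries(1)[OF A v]
        by (intro sum.cong refl) (simp add: power2_eq_square)
      then show ?thesis by (simp add: sum_distrib_left mult_ac)
    qed
    then have "\<bar>k\<bar> * N = \<bar>\<Sum>i<n. \<Sum>j<n. A $$ (i, j) * (v $ i * v $ j)\<bar>"
      using N by (metis abs_mult abs_of_pos)
    also have "\<dots> \<le> (\<Sum>i<n. \<Sum>j<n. \<bar>A $$ (i, j) * (v $ i * v $ j)\<bar>)"
      by (intro order_trans[OF sum_abs] sum_mono) auto
    also have "\<dots> = (\<Sum>i<n. \<Sum>j<n. A $$ (i, j) * (x i * x j)) * N"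
      unfolding sum_distrib_right using N A0
      by (intro sum.cong refl) (simp add: xx abs_mult)
    finally show "\<bar>k\<bar> \<le> (\<Sum>i<n. \<Sum>j<n. A $$ (i, j) * (x i * x j))"
      using N by simp
  qed
qed

section \<open>Adjacency matrices and counting edges\<close>

lemma adjacency_matrix_carrier: "adjacency_matrix n E \<in> carrier_mat n n"
  by (simp add: adjacency_matrix_def)

lemma adjacency_matrix_entry:
  "i < n \<Longrightarrow> j < n \<Longrightarrow> adjacency_matrix n E $$ (i, j) = (if {i, j} \<in> E then 1 else 0)"
  by (simp add: adjacency_matrix_def)

lemma largest_eigenvalue_is_eigenvalue:
  assumes "n > 0"
  shows "eigenvalue (adjacency_matrix n E) (largest_eigenvalue n E)"
proof -
  have "spectrum (adjacency_matrix n E) \<noteq> {}"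
    by (rule symmetric_mat_spectrum_nonempty[OF adjacency_matrix_carrier assms])
      (simp add: adjacency_matrix_entry insert_commute)
  then have "largest_eigenvalue n E \<in> spectrum (adjacency_matrix n E)"
    unfolding largest_eigenvalue_def
    using card_finite_spectrum(1)[OF adjacency_matrix_carrier] by (intro Max_in)
  then show ?thesis by (simp add: spectrum_def)
qed

lemma simple_graph_finite: "simple_graph n E \<Longrightarrow> finite E"
  by (rule finite_subset[of _ "Pow {..<n}"]) (auto simp: simple_graph_def)

text \<open>The adjacent ordered pairs split into the fibres \<open>D e\<close>, each of size
  two.\<close>

lemma handshake:
  assumes "simple_graph n E"
  shows "(\<Sum>i<n. \<Sum>j<n. if {i, j} \<in> E then 1 else 0 :: real) = 2 * real (card E)"
proof -
  define D where "D e = {(i, j). {i, j} = e}" for e :: "nat set"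
  have D: "finite (D e) \<and> card (D e) = 2" if "e \<in> E" for e
  proof -
    have "card e = 2" using assms that by (simp add: simple_graph_def)
    then obtain a b where "e = {a, b}" "a \<noteq> b" by (auto simp: card_2_iff)
    then have "D e = {(a, b), (b, a)}" by (auto simp: D_def doubleton_eq_iff)
    with \<open>a \<noteq> b\<close> show ?thesis by simp
  qed
  have "(\<Sum>i<n. \<Sum>j<n. if {i, j} \<in> E then 1 else 0 :: real)
      = (\<Sum>p\<in>{..<n}\<times>{..<n}. if {fst p, snd p} \<in> E then 1 else 0)"
    by (simp add: sum.cartesian_product case_prod_beta)
  also have "\<dots> = real (card {p \<in> {..<n}\<times>{..<n}. {fst p, snd p} \<in> E})"
    by (simp add: sum.If_cases Int_def)
  also have "{p \<in> {..<n}\<times>{..<n}. {fst p, snd p} \<in> E} = (\<Union>e\<in>E. D e)"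
    using assms by (auto simp: D_def simple_graph_def)
  also have "card \<dots> = (\<Sum>e\<in>E. card (D e))"
    using simple_graph_finite[OF assms] D by (intro card_UN_disjoint) (auto simp: D_def)
  also have "\<dots> = 2 * card E" using D by simp
  finally show ?thesis by simp
qed

section \<open>Books from cliques\<close>

lemma contains_bookI:
  assumes R: "R \<subseteq> {..<n}" "card R = r" and W: "W \<subseteq> {..<n}" "card W = k"
    and RR: "\<And>i j. i \<in> R \<Longrightarrow> j \<in> R \<Longrightarrow> i \<noteq> j \<Longrightarrow> {i, j} \<in> E"
    and RW: "\<And>i j. i \<in> R \<Longrightarrow> j \<in> W \<Longrightarrow> {i, j} \<in> E" and disj: "R \<inter> W = {}"
  shows "contains_book n E r k"
proof -
  have fin: "finite R" "finite W" using R W finite_subset by blast+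
  obtain f where f: "bij_betw f {0..<r} R" using ex_bij_betw_nat_finite[OF fin(1)] R by auto
  obtain g where g: "bij_betw g {0..<k} W" using ex_bij_betw_nat_finite[OF fin(2)] W by auto
  define \<phi> where "\<phi> i = (if i < r then f i else g (i - r))" for i
  have fR: "\<phi> i \<in> R" if "i < r" for i using f that by (auto simp: \<phi>_def bij_betw_def)
  have gW: "\<phi> i \<in> W" if "\<not> i < r" "i < r + k" for i
    using g that by (auto simp: \<phi>_def bij_betw_def)
  have finj: "i = j" if "f i = f j" "i < r" "j < r" for i j
    using f that by (auto simp: bij_betw_def inj_on_def)
  have ginj: "i = j" if "g (i - r) = g (j - r)" "\<not> i < r" "\<not> j < r" "i < r + k" "j < r + k" for i j
  proof -
    have "i - r = j - r" using g that by (auto simp: bij_betw_def inj_on_def)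
    with that show ?thesis by simp
  qed
  have inj: "inj_on \<phi> {..<r + k}"
  proof (rule inj_onI)
    fix i j assume ij: "i \<in> {..<r + k}" "j \<in> {..<r + k}" "\<phi> i = \<phi> j"
    then have "i < r \<longleftrightarrow> j < r" using fR[of i] fR[of j] gW[of i] gW[of j] disj by auto
    then show "i = j" using ij finj[of i j] ginj[of i j] by (auto simp: \<phi>_def split: if_splits)
  qed
  have "\<phi> ` {..<r + k} \<subseteq> {..<n}" using fR gW R W by blast
  moreover have "\<phi> ` e \<in> E" if "e \<in> book_edges r k" for e
  proof -
    from that consider i j where "e = {i, j}" "i < r" "j < r" "i \<noteq> j"
      | i j where "e = {i, j}" "i < r" "r \<le> j" "j < r + k"
      unfolding book_edges_def by blast
    then show ?thesis
    proof cases
      case 1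
      then have "\<phi> i \<noteq> \<phi> j" using inj by (auto simp: inj_on_def)
      with 1 show ?thesis using RR[OF fR fR] by simp
    next
      case 2
      then show ?thesis using RW[OF fR gW] by simp
    qed
  qed
  ultimately show ?thesis using inj unfolding contains_copy_def by blast
qed

text \<open>A vertex with \<open>r\<close> neighbours in \<open>Q\<close> misses at most one
  \<open>u\<close> in \<open>Q\<close>, so it lies in the common neighbourhood \<open>N u\<close> of
  \<open>Q - {u}\<close>. These \<open>r + 1\<close> sets cover all such vertices, and the
  pigeonhole principle gives a large one, whose members are the pages over
  \<open>Q - {u}\<close>.\<close>

lemma book_from_near_neighbours:
  assumes Q: "Q \<subseteq> {..<n}" "card Q = r + 1" and irr: "\<And>i. {i} \<notin> E"
    and QQ: "\<And>i j. i \<in> Q \<Longrightarrow> j \<in> Q \<Longrightarrow> i \<noteq> j \<Longrightarrow> {i, j} \<in> E"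
  obtains k where "card {j \<in> {..<n}. r \<le> card {v \<in> Q. {v, j} \<in> E}} \<le> (r + 1) * k"
    "contains_book n E r k"
proof -
  define T where "T = {j \<in> {..<n}. r \<le> card {v \<in> Q. {v, j} \<in> E}}"
  define N where "N u = {j \<in> {..<n}. \<forall>v\<in>Q - {u}. {v, j} \<in> E}" for u
  have finQ: "finite Q" using Q finite_subset by blast
  have "T \<subseteq> (\<Union>u\<in>Q. N u)"
  proof
    fix j assume j: "j \<in> T"
    define M where "M = Q - {v \<in> Q. {v, j} \<in> E}"
    have "card M = card Q - card {v \<in> Q. {v, j} \<in> E}"
      unfolding M_def using finQ by (intro card_Diff_subset) auto
    then have "card M \<le> Suc 0" using j Q(2) unfolding T_def mem_Collect_eq by linarith
    then have M1: "\<And>a b. a \<in> M \<Longrightarrow> b \<in> M \<Longrightarrow> a = b"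
      using finQ card_le_Suc0_iff_eq[of M] by (auto simp: M_def)
    obtain u0 where "u0 \<in> Q" using Q by fastforce
    \<comment> \<open>If \<open>j\<close> is adjacent to all of \<open>Q\<close>, any vertex of
      \<open>Q\<close> may play the role of the missed one.\<close>
    define u where "u = (if M = {} then u0 else (SOME a. a \<in> M))"
    have "u \<in> Q" "M \<subseteq> {u}"
      using \<open>u0 \<in> Q\<close> M1 some_in_eq[of M] by (auto simp: u_def M_def[symmetric] split: if_splits) (auto simp: M_def)
    then show "j \<in> (\<Union>u\<in>Q. N u)" using j by (auto simp: N_def T_def M_def)
  qed
  then have "card T \<le> card (\<Union>u\<in>Q. N u)" using finQ by (intro card_mono) (auto simp: N_def)
  also have "\<dots> \<le> (\<Sum>u\<in>Q. card (N u))" by (rule card_UN_le[OF finQ])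
  finally have le: "card T \<le> (\<Sum>u\<in>Q. card (N u))" .
  have "\<exists>u\<in>Q. card T \<le> (r + 1) * card (N u)"
  proof (rule ccontr)
    assume "\<not> ?thesis"
    then have "(\<Sum>u\<in>Q. (r + 1) * card (N u)) < (\<Sum>u\<in>Q. card T)"
      using finQ Q by (intro sum_strict_mono) auto
    then have "(r + 1) * (\<Sum>u\<in>Q. card (N u)) < (r + 1) * card T"
      using Q by (simp only: sum_distrib_left[symmetric] sum_constant of_nat_id)
    with mult_le_mono2[OF le, of "r + 1"] show False by simp
  qed
  then obtain u where u: "u \<in> Q" "card T \<le> (r + 1) * card (N u)" by blast
  have "contains_book n E r (card (N u))"
  proof (rule contains_bookI[where R = "Q - {u}" and W = "N u"])
    \<comment> \<open>A common vertex would be adjacent to itself.\<close>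
    show "(Q - {u}) \<inter> N u = {}" using irr by (force simp: N_def)
  qed (use Q u QQ finQ in \<open>auto simp: N_def\<close>)
  then show thesis using that u by (simp add: T_def)
qed

section \<open>Large eigenvalues force large books\<close>

lemma spectral_book:
  assumes "r \<ge> 2" and G: "simple_graph n E"
    and large: "(largest_eigenvalue n E)\<^sup>2 > (1 - 1 / real r) * (2 * real (card E))"
  shows "\<exists>k. real k \<ge> book_const r / (real r + 1) * sqrt (real (card E)) \<and> contains_book n E r k"
proof -
  define m where "m = card E"
  have n: "n > 0" using G by (simp add: simple_graph_def)
  have irr: "{i} \<notin> E" for i using G by (auto simp: simple_graph_def dest!: bspec)
  obtain x :: "nat \<Rightarrow> real" where x0: "\<And>i. x i \<ge> 0" and one: "(\<Sum>i<n. (x i)\<^sup>2) = 1" and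
    le: "\<bar>largest_eigenvalue n E\<bar> \<le> (\<Sum>i<n. \<Sum>j<n. adjacency_matrix n E $$ (i, j) * (x i * x j))"
    by (rule eigenvalue_le_nonneg_form[OF adjacency_matrix_carrier largest_eigenvalue_is_eigenvalue[OF n, of E]])
      (auto simp: adjacency_matrix_entry)
  define L where "L = (\<Sum>i<n. \<Sum>j<n. if {i, j} \<in> E then x i * x j else 0)"
  have "(\<Sum>i<n. \<Sum>j<n. adjacency_matrix n E $$ (i, j) * (x i * x j)) = L"
    unfolding L_def by (intro sum.cong refl) (simp add: adjacency_matrix_entry)
  with le have lL: "\<bar>largest_eigenvalue n E\<bar> \<le> L" by simp
  then have L0: "L \<ge> 0" by linarith
  have "(largest_eigenvalue n E)\<^sup>2 \<le> L\<^sup>2" using power_mono[OF lL, of 2] by simp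
  with large have L2: "L\<^sup>2 > (1 - 1 / real r) * (2 * real m)" by (simp add: m_def)
  moreover have "(1 - 1 / real r) * (2 * real m) \<ge> 0" using \<open>r \<ge> 2\<close> by simp
  ultimately have Lpos: "L > 0" using L0 by (cases "L = 0") auto
  \<comment> \<open>Cauchy--Schwarz over ordered pairs, pairing the edge indicator with
    \<open>x i * x j\<close>, whose squares sum to 1.\<close>
  have "L\<^sup>2 \<le> 2 * real m"
  proof -
    define P where "P = {..<n} \<times> {..<n}"
    have "L = (\<Sum>p\<in>P. (if {fst p, snd p} \<in> E then 1 else 0) * (x (fst p) * x (snd p)))"
      unfolding L_def P_def sum.cartesian_product by (intro sum.cong) (auto simp: case_prod_beta)
    also have "\<dots>\<^sup>2 \<le> (\<Sum>p\<in>P. (if {fst p, snd p} \<in> E then 1 else 0)\<^sup>2) * (\<Sum>p\<in>P. (x (fst p) * x (snd p))\<^sup>2)"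
      by (rule Cauchy_Schwarz_ineq_sum)
    also have "(\<Sum>p\<in>P. (if {fst p, snd p} \<in> E then 1 else 0)\<^sup>2) = (\<Sum>i<n. \<Sum>j<n. if {i, j} \<in> E then 1 else 0 :: real)"
      unfolding P_def sum.cartesian_product by (intro sum.cong) (auto simp: case_prod_beta)
    also have "\<dots> = 2 * real m" unfolding m_def by (rule handshake[OF G])
    also have "(\<Sum>p\<in>P. (x (fst p) * x (snd p))\<^sup>2) = (\<Sum>i<n. (x i)\<^sup>2) * (\<Sum>j<n. (x j)\<^sup>2)"
      unfolding P_def sum_product sum.cartesian_product by (intro sum.cong) (auto simp: case_prod_beta power_mult_distrib)
    finally show ?thesis using one by simp
  qed
  then have m: "real m > 0" using Lpos by (smt (verit) zero_less_power)
  have Lm: "L \<le> 2 * sqrt (real m)"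
  proof (rule power2_le_imp_le)
    show "L\<^sup>2 \<le> (2 * sqrt (real m))\<^sup>2" using \<open>L\<^sup>2 \<le> 2 * real m\<close> by (simp add: power_mult_distrib)
  qed simp
  \<comment> \<open>This is the maximiser of \<open>2 * t * L - t\<^sup>2 * (2 * m)\<close> over
    \<open>t\<close>; the maximum is \<open>L\<^sup>2 / (2 * m)\<close>, so before truncation the
    weights lose nothing.\<close>
  define \<tau> where "\<tau> = L / (2 * real m)"
  have \<tau>: "\<tau> > 0" using Lpos m by (simp add: \<tau>_def)
  have s2: "(sqrt \<tau>)\<^sup>2 = \<tau>" "sqrt \<tau> ^ 4 = \<tau>\<^sup>2"
    using \<tau> power_mult[of "sqrt \<tau>" 2 2] by auto
  have "1 - 1 / real r < L\<^sup>2 / (2 * real m)" using L2 m by (simp add: field_simps)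
  also have "\<dots> = 2 * \<tau> * L - \<tau>\<^sup>2 * (2 * real m)"
    using m by (simp add: \<tau>_def field_simps power2_eq_square)
  also have "\<dots> = (\<Sum>i<n. \<Sum>j<n. 2 * \<tau> * (if {i, j} \<in> E then x i * x j else 0) - \<tau>\<^sup>2 * (if {i, j} \<in> E then 1 else 0))"
    unfolding L_def m_def handshake[OF G, symmetric] sum_distrib_left sum_subtractf by simp
  also have "\<dots> \<le> (\<Sum>i<n. \<Sum>j<n. if {i, j} \<in> E then max 0 (2 * (sqrt \<tau>)\<^sup>2 * (x i * x j) - sqrt \<tau> ^ 4) else 0)"
    unfolding s2 by (intro sum_mono) auto
  finally have dense: "1 - 1 / real r < \<dots>" .
  obtain Q where Q: "Q \<subseteq> {..<n}" "card Q = r + 1" "\<And>i j. i \<in> Q \<Longrightarrow> j \<in> Q \<Longrightarrow> i \<noteq> j \<Longrightarrow> {i, j} \<in> E"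
    and T: "(sqrt \<tau>)\<^sup>2 * real (card {j \<in> {..<n}. r \<le> card {v \<in> Q. {v, j} \<in> E}}) \<ge> book_const r"
    by (rule clique_with_many_near_neighbours[OF finite_lessThan \<open>r \<ge> 2\<close> _ _ x0 one _ dense])
      (use \<tau> irr in \<open>auto simp: insert_commute\<close>)
  obtain k where k: "card {j \<in> {..<n}. r \<le> card {v \<in> Q. {v, j} \<in> E}} \<le> (r + 1) * k" "contains_book n E r k"
    using book_from_near_neighbours[OF Q(1,2) irr Q(3)] by blast
  have "book_const r \<le> \<tau> * real ((r + 1) * k)"
    using T k(1) \<tau> unfolding s2 by (smt (verit) mult_left_mono of_nat_mono)
  also have "\<dots> \<le> (2 * sqrt (real m) / (2 * real m)) * real ((r + 1) * k)"
    unfolding \<tau>_def using Lm m by (intro mult_right_mono divide_right_mono) auto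
  also have "\<dots> = real ((r + 1) * k) / sqrt (real m)"
    using m by (simp add: field_simps)
  finally have "book_const r / (real r + 1) * sqrt (real m) \<le> real k"
    using m by (simp add: field_simps)
  then show ?thesis using k(2) unfolding m_def by blast
qed

section \<open>Sharpness from complete graphs\<close>

text \<open>The constant vector has eigenvalue \<open>n - 1\<close> and
  \<open>2 * card E = n * (n - 1)\<close>, so the spectral condition follows from
  \<open>n - 1 > (1 - 1 / r) * n\<close>, which amounts to \<open>n > r\<close>. A book has at most
  \<open>n\<close> vertices, which is of order the square root of the number of edges.\<close>

lemma complete_graph_extremal:
  fixes n r :: nat
  assumes "r \<ge> 2" "n > r"
  defines "E \<equiv> {e. e \<subseteq> {..<n} \<and> card e = 2}"
  shows "simple_graph n E" "card E = n choose 2"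
    "(largest_eigenvalue n E)\<^sup>2 > (1 - 1 / real r) * (2 * real (card E))"
    "contains_book n E r k \<Longrightarrow> real k \<le> 2 * sqrt (real (card E))"
proof -
  show "simple_graph n E" using assms by (auto simp: simple_graph_def)
  show cE: "card E = n choose 2" unfolding E_def using n_subsets[of "{..<n}" 2] by simp
  have even: "even (n * (n - 1))" by (cases "even n") auto
  have cE': "2 * real (card E) = real n * (real n - 1)"
  proof -
    have "2 * card E = n * (n - 1)" using cE even by (simp add: choose_two)
    then have "real (2 * card E) = real (n * (n - 1))" by simp
    then show ?thesis using assms by (simp add: of_nat_diff)
  qed
  let ?A = "adjacency_matrix n E"
  have "eigenvector ?A (vec n (\<lambda>_. 1)) (real n - 1)"
    unfolding eigenvector_def
  proof (intro conjI)
    show "vec n (\<lambda>_. 1 :: real) \<in> carrier_vec (dim_row ?A)" by (simp add: adjacency_matrix_def)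
    have "vec n (\<lambda>_. 1 :: real) $ 0 \<noteq> 0\<^sub>v n $ 0" using assms by simp
    then have "vec n (\<lambda>_. 1 :: real) \<noteq> 0\<^sub>v n" by metis
    then show "vec n (\<lambda>_. 1 :: real) \<noteq> 0\<^sub>v (dim_row ?A)" by (simp add: adjacency_matrix_def)
    show "?A *\<^sub>v vec n (\<lambda>_. 1) = (real n - 1) \<cdot>\<^sub>v vec n (\<lambda>_. 1)"
    proof (rule eq_vecI)
      fix i assume "i < dim_vec ((real n - 1) \<cdot>\<^sub>v vec n (\<lambda>_. 1))"
      then have i: "i < n" by simp
      have "(?A *\<^sub>v vec n (\<lambda>_. 1)) $ i = (\<Sum>j<n. if j = i then 0 else 1)"
        using i by (auto simp: adjacency_matrix_def scalar_prod_def lessThan_atLeast0 E_def card_insert_if intro!: sum.cong)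
      also have "\<dots> = (\<Sum>j<n. 1 - (if j = i then 1 else 0))" by (intro sum.cong) auto
      also have "\<dots> = real n - 1" using i by (simp add: sum_subtractf)
      finally show "(?A *\<^sub>v vec n (\<lambda>_. 1)) $ i = ((real n - 1) \<cdot>\<^sub>v vec n (\<lambda>_. 1)) $ i" using i by simp
    qed (simp add: adjacency_matrix_def)
  qed
  then have "real n - 1 \<in> spectrum ?A" by (auto simp: spectrum_def eigenvalue_def)
  then have "real n - 1 \<le> largest_eigenvalue n E"
    unfolding largest_eigenvalue_def
    using card_finite_spectrum(1)[OF adjacency_matrix_carrier] by (intro Max_ge)
  then have ge: "(real n - 1)\<^sup>2 \<le> (largest_eigenvalue n E)\<^sup>2" using assms by (intro power_mono) auto
  have "(1 - 1 / real r) * real n < real n - 1" using assms by (simp add: field_simps)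
  then have "(1 - 1 / real r) * real n * (real n - 1) < (real n - 1) * (real n - 1)"
    using assms by (intro mult_strict_right_mono) auto
  then show "(largest_eigenvalue n E)\<^sup>2 > (1 - 1 / real r) * (2 * real (card E))"
    using ge unfolding cE' by (simp add: power2_eq_square mult.assoc)
  assume "contains_book n E r k"
  then obtain f where "inj_on f {..<r + k}" "f ` {..<r + k} \<subseteq> {..<n}" by (auto simp: contains_copy_def)
  then have "card {..<r + k} \<le> card {..<n}" by (intro card_inj_on_le) auto
  then have "real k \<le> real n" by simp
  also have "real n \<le> 2 * sqrt (real (card E))"
  proof (rule power2_le_imp_le)
    \<comment> \<open>As \<open>n \<ge> 2\<close>, the square of \<open>n\<close> is at most
      \<open>2 * n * (n - 1)\<close>, which is \<open>4 * card E\<close>.\<close>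
    have "real n * 2 \<le> real n * real n" using assms by (intro mult_left_mono) auto
    then show "(real n)\<^sup>2 \<le> (2 * sqrt (real (card E)))\<^sup>2"
      using cE' by (simp add: power_mult_distrib power2_eq_square algebra_simps)
  qed simp
  finally show "real k \<le> 2 * sqrt (real (card E))" .
qed

theorem theorem1p4:
  fixes r :: nat
  assumes "r \<ge> 2"
  shows "(\<exists>c::real. c > 0 \<and>
            (\<forall>n E m. simple_graph n E \<and> card E = m \<and>
               (largest_eigenvalue n E)\<^sup>2 > (1 - 1 / real r) * (2 * real m) \<longrightarrow>
               (\<exists>k::nat. real k \<ge> c * sqrt (real m) \<and> contains_book n E r k))) \<and>
         (\<exists>C::real. infinite {m::nat. \<exists>n E. simple_graph n E \<and> card E = m \<and>
               (largest_eigenvalue n E)\<^sup>2 > (1 - 1 / real r) * (2 * real m) \<and>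
               \<not> (\<exists>k::nat. real k > C * sqrt (real m) \<and> contains_book n E r k)})"
proof
  show "\<exists>c::real. c > 0 \<and>
            (\<forall>n E m. simple_graph n E \<and> card E = m \<and>
               (largest_eigenvalue n E)\<^sup>2 > (1 - 1 / real r) * (2 * real m) \<longrightarrow>
               (\<exists>k::nat. real k \<ge> c * sqrt (real m) \<and> contains_book n E r k))"
    using spectral_book[OF assms] book_const_pos[OF assms]
    by (intro exI[of _ "book_const r / (real r + 1)"]) auto
  show "\<exists>C::real. infinite {m::nat. \<exists>n E. simple_graph n E \<and> card E = m \<and>
               (largest_eigenvalue n E)\<^sup>2 > (1 - 1 / real r) * (2 * real m) \<and>
               \<not> (\<exists>k::nat. real k > C * sqrt (real m) \<and> contains_book n E r k)}"
    (is "\<exists>C. infinite (?S C)")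
  proof (rule exI[of _ 2], unfold infinite_nat_iff_unbounded, intro allI)
    fix M
    \<comment> \<open>Large enough for \<open>n > r\<close> and for \<open>n - 1 \<ge> 2\<close>,
      whence \<open>n choose 2\<close> is at least \<open>n\<close> and exceeds
      \<open>M\<close>.\<close>
    define n where "n = r + M + 3"
    have "n \<le> n choose 2"
    proof -
      have "n * 2 \<le> n * (n - 1)" unfolding n_def by (intro mult_left_mono) auto
      then show ?thesis unfolding choose_two by linarith
    qed
    then have "n choose 2 > M" by (simp add: n_def)
    moreover have "n choose 2 \<in> ?S 2"
      using complete_graph_extremal[OF assms, of n] by (fastforce simp: n_def not_less)
    ultimately show "\<exists>m>M. m \<in> ?S 2" by blast
  qed
qed

end
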